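(* Let $1 \le p < \infty$, let $\Omega$ be a bounded symmetric domain in $\mathbf{C}^n$ (in its standard representation), and let $\lambda < \varepsilon_\Omega$. Let $\varphi:\Omega\to\mathbf{C}^n$ be holomorphic with $\varphi(\Omega)\subseteq\Omega$ and let $\psi \in A^p_\lambda(\Omega, dV_\lambda)$. Then the weighted composition operator $W_{\varphi,\psi}$ is bounded on $A^p_\lambda(\Omega, dV_\lambda)$ if and only if the measure $\mu_{\varphi,\psi,p}$ is a Carleson measure on $A^p_\lambda(\Omega, dV_\lambda)$.
   Context: $\Omega$ is a bounded symmetric domain in $\mathbf{C}^n$ in its standard (Harish-Chandra, i.e. circular and centred at $0$) representation, with volume measure $dV$ normalized so that $V(\Omega)=1$; $K(z,\omega)$ is its Bergman kernel with respect to $dV$, so that $K(z,0)=K(0,\omega)=1$ for all $z,\omega\in\Omega$. $K(z,\omega)\neq 0$ for all $z,\omega\in\Omega$. $\varepsilon_\Omega>0$ is a number such that $C_\lambda=\int_\Omega K(z,z)^\lambda\,dV(z)<\infty$ for every real $\lambda<\varepsilon_\Omega$. For such $\lambda$, $dV_\lambda(z)=C_\lambda^{-1}K(z,z)^\lambda\,dV(z)$ is a probability measure. $A^p_\lambda(\Omega,dV_\lambda)$ is the weighted Bergman space of holomorphic functions $f$ on $\Omega$ with $\|f\|_{A^p_\lambda}=\left(\int_\Omega|f|^p\,dV_\lambda\right)^{1/p}<\infty$. The weighted composition operator is $W_{\varphi,\psi}f(z)=\psi(z)f(\varphi(z))$, $z\in\Omega$, for $f$ holomorphic on $\Omega$.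 The measure $\mu_{\varphi,\psi,p}$ is defined by $\mu_{\varphi,\psi,p}(E)=\int_{\varphi^{-1}(E)}|\psi|^p\,dV_\lambda$ for measurable $E\subseteq\Omega$. A finite positive Borel measure $\mu$ on $\Omega$ is a Carleson measure on $A^p_\lambda(\Omega,dV_\lambda)$ if it satisfies one of the following conditions, which are known to be equivalent: (1) the inclusion map $A^p_\lambda(\Omega,dV_\lambda)\to L^p(\Omega,d\mu)$ is bounded; (2) the Berezin transform $\tilde\mu_\lambda(z)=\int_\Omega|k_z(\omega)|^{2(1-\lambda)}\,d\mu(\omega)$ is bounded on $\Omega$, where $k_z(\omega)=K(\omega,z)/\sqrt{K(z,z)}$; (3) for some (equivalently, all) $r>0$ the function $\mu(E(z,r))/|E(z,r)|^{1-\lambda}$ is bounded in $z\in\Omega$, where $E(z,r)=\{\omega\in\Omega:\beta(z,\omega)<r\}$, $\beta$ is the Bergman distance and $|E(z,r)|=V(E(z,r))$. *)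

theory Defs
  imports "HOL-Analysis.Analysis"
begin

section \<open>Holomorphic functions and maps in several variables\<close>

definition holomorphic_fun :: "(complex ^ 'n \<Rightarrow> complex) \<Rightarrow> (complex ^ 'n) set \<Rightarrow> bool" where
  "holomorphic_fun f \<Omega> \<longleftrightarrow>
     (\<forall>z\<in>\<Omega>. \<exists>D. (f has_derivative D) (at z) \<and> (\<forall>c v. D (c *s v) = c * D v))"

definition holomorphic_map :: "(complex ^ 'n \<Rightarrow> complex ^ 'm) \<Rightarrow> (complex ^ 'n) set \<Rightarrow> bool" where
  "holomorphic_map f \<Omega> \<longleftrightarrow> (\<forall>i. holomorphic_fun (\<lambda>z. f z $ i) \<Omega>)"


section \<open>Bounded symmetric domains\<close>

text \<open>Symmetric in the sense of Cartan: each point is an isolated fixed point of an involutive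
  holomorphic automorphism (holomorphic and involutive implies biholomorphic).\<close>

definition bounded_symmetric_domain :: "(complex ^ 'n) set \<Rightarrow> bool" where
  "bounded_symmetric_domain \<Omega> \<longleftrightarrow>
     open \<Omega> \<and> connected \<Omega> \<and> \<Omega> \<noteq> {} \<and> bounded \<Omega> \<and>
     (\<forall>a\<in>\<Omega>. \<exists>s. holomorphic_map s \<Omega> \<and> s ` \<Omega> \<subseteq> \<Omega> \<and> (\<forall>z\<in>\<Omega>. s (s z) = z) \<and>
        s a = a \<and> (\<exists>e>0. \<forall>z\<in>\<Omega> \<inter> ball a e. s z = z \<longrightarrow> z = a))"

definition standard_bounded_symmetric_domain :: "(complex ^ 'n) set \<Rightarrow> bool" where
  "standard_bounded_symmetric_domain \<Omega> \<longleftrightarrow>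
     bounded_symmetric_domain \<Omega> \<and> 0 \<in> \<Omega> \<and>
     (\<forall>z\<in>\<Omega>. \<forall>c. cmod c = 1 \<longrightarrow> c *s z \<in> \<Omega>)"


section \<open>Bergman spaces and the Bergman kernel\<close>

text \<open>Lebesgue measure normalized to total mass 1, as a measure whose underlying space is
  \<open>\<Omega>\<close>.\<close>

definition volume_measure :: "(complex ^ 'n) set \<Rightarrow> (complex ^ 'n) measure" where
  "volume_measure \<Omega> = restrict_space (uniform_measure lborel \<Omega>) \<Omega>"

definition Lp_functions :: "'a measure \<Rightarrow> real \<Rightarrow> ('a \<Rightarrow> complex) set" where
  "Lp_functions M p = {f \<in> borel_measurable M. integrable M (\<lambda>z. cmod (f z) powr p)}"

definition Lp_norm :: "'a measure \<Rightarrow> real \<Rightarrow> ('a \<Rightarrow> complex) \<Rightarrow> real" where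
  "Lp_norm M p f = (\<integral>z. cmod (f z) powr p \<partial>M) powr (1 / p)"

text \<open>Functions are total in HOL; the values of a member of a Bergman space outside
  \<open>\<Omega>\<close> are unconstrained and play no role.\<close>

definition bergman_space ::
  "(complex ^ 'n) set \<Rightarrow> (complex ^ 'n) measure \<Rightarrow> real \<Rightarrow> (complex ^ 'n \<Rightarrow> complex) set" where
  "bergman_space \<Omega> M p = {f. holomorphic_fun f \<Omega> \<and> f \<in> Lp_functions M p}"

text \<open>\<open>K(\<cdot>, w)\<close> is the function in \<open>A\<^sup>2(\<Omega>, dV)\<close> reproducing the value at \<open>w\<close>; it is extended
  by 0 outside \<open>\<Omega>\<close> only to make it unique as a total function.\<close>

definition bergman_kernel ::
  "(complex ^ 'n) set \<Rightarrow> complex ^ 'n \<Rightarrow> complex ^ 'n \<Rightarrow> complex" where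
  "bergman_kernel \<Omega> z w =
     (THE k. k \<in> bergman_space \<Omega> (volume_measure \<Omega>) 2 \<and> (\<forall>x. x \<notin> \<Omega> \<longrightarrow> k x = 0) \<and>
        (\<forall>f\<in>bergman_space \<Omega> (volume_measure \<Omega>) 2.
           f w = (\<integral>x. f x * cnj (k x) \<partial>volume_measure \<Omega>))) z"

text \<open>\<open>K(z, z)\<close> is real and positive, so taking \<open>Re\<close> is only a change of type.\<close>

definition kernel_power :: "(complex ^ 'n) set \<Rightarrow> real \<Rightarrow> complex ^ 'n \<Rightarrow> real" where
  "kernel_power \<Omega> lam z = Re (bergman_kernel \<Omega> z z) powr lam"

definition weight_constant :: "(complex ^ 'n) set \<Rightarrow> real \<Rightarrow> real" where
  "weight_constant \<Omega> lam = (\<integral>z. kernel_power \<Omega> lam z \<partial>volume_measure \<Omega>)"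

definition weighted_measure :: "(complex ^ 'n) set \<Rightarrow> real \<Rightarrow> (complex ^ 'n) measure" where
  "weighted_measure \<Omega> lam =
     density (volume_measure \<Omega>) (\<lambda>z. ennreal (kernel_power \<Omega> lam z / weight_constant \<Omega> lam))"

abbreviation weighted_bergman_space ::
  "(complex ^ 'n) set \<Rightarrow> real \<Rightarrow> real \<Rightarrow> (complex ^ 'n \<Rightarrow> complex) set" where
  "weighted_bergman_space \<Omega> lam p \<equiv> bergman_space \<Omega> (weighted_measure \<Omega> lam) p"

abbreviation weighted_bergman_norm ::
  "(complex ^ 'n) set \<Rightarrow> real \<Rightarrow> real \<Rightarrow> (complex ^ 'n \<Rightarrow> complex) \<Rightarrow> real" where
  "weighted_bergman_norm \<Omega> lam p \<equiv> Lp_norm (weighted_measure \<Omega> lam) p"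


section \<open>Weighted composition operators and Carleson measures\<close>

text \<open>Boundedness of a map between (semi)normed function spaces given as sets. It is applied only
  to weighted composition operators and to inclusions, which are linear by their form.\<close>

definition bounded_operator ::
  "'f set \<Rightarrow> ('f \<Rightarrow> real) \<Rightarrow> 'g set \<Rightarrow> ('g \<Rightarrow> real) \<Rightarrow> ('f \<Rightarrow> 'g) \<Rightarrow> bool" where
  "bounded_operator X normX Y normY T \<longleftrightarrow>
     (\<forall>f\<in>X. T f \<in> Y) \<and> (\<exists>C. \<forall>f\<in>X. normY (T f) \<le> C * normX f)"

definition weighted_composition ::
  "('a \<Rightarrow> 'a) \<Rightarrow> ('a \<Rightarrow> complex) \<Rightarrow> ('a \<Rightarrow> complex) \<Rightarrow> 'a \<Rightarrow> complex" where
  "weighted_composition \<phi> \<psi> f = (\<lambda>z. \<psi> z * f (\<phi> z))"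

definition pushforward_measure ::
  "(complex ^ 'n) set \<Rightarrow> real \<Rightarrow> (complex ^ 'n \<Rightarrow> complex ^ 'n) \<Rightarrow> (complex ^ 'n \<Rightarrow> complex) \<Rightarrow>
     real \<Rightarrow> (complex ^ 'n) measure" where
  "pushforward_measure \<Omega> lam \<phi> \<psi> p =
     distr (density (weighted_measure \<Omega> lam) (\<lambda>z. ennreal (cmod (\<psi> z) powr p)))
       (restrict_space borel \<Omega>) \<phi>"

text \<open>Of the known equivalent conditions (bounded inclusion, bounded Berezin transform, averages over
  Bergman balls), boundedness of the inclusion into \<open>L\<^sup>p(\<mu>)\<close> is taken as the definition.\<close>

definition carleson_measure ::
  "(complex ^ 'n) set \<Rightarrow> real \<Rightarrow> real \<Rightarrow> (complex ^ 'n) measure \<Rightarrow> bool" where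
  "carleson_measure \<Omega> lam p \<mu> \<longleftrightarrow>
     finite_measure \<mu> \<and> sets \<mu> = sets (restrict_space borel \<Omega>) \<and>
     bounded_operator (weighted_bergman_space \<Omega> lam p) (weighted_bergman_norm \<Omega> lam p)
       (Lp_functions \<mu> p) (Lp_norm \<mu> p) (\<lambda>f. f)"


section \<open>Checks of the definitions\<close>

lemma space_volume_measure [simp]: "space (volume_measure \<Omega>) = \<Omega>"
  by (simp add: volume_measure_def space_restrict_space)

lemma sets_volume_measure: "sets (volume_measure \<Omega>) = sets (restrict_space borel \<Omega>)"
  unfolding volume_measure_def by (rule sets_restrict_space_cong) simp

lemma emeasure_volume_measure:
  fixes \<Omega> :: "(complex ^ 'n) set"
  assumes "open \<Omega>" "bounded \<Omega>" "\<Omega> \<noteq> {}"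
  shows "emeasure (volume_measure \<Omega>) \<Omega> = 1"
proof -
  have "emeasure lborel \<Omega> \<noteq> 0"
    using assms open_not_negligible[of \<Omega>] negligible_iff_emeasure0[of \<Omega>]
    by (auto simp: borel_open)
  moreover have "emeasure lborel \<Omega> \<noteq> \<infinity>"
    using emeasure_bounded_finite[OF assms(2)] by auto
  moreover have "\<Omega> \<in> sets borel" using assms(1) by simp
  ultimately show ?thesis
    by (simp add: volume_measure_def emeasure_restrict_space ennreal_divide_self less_top)
qed

text \<open>The pushforward measure has the expected values: it sends \<open>E\<close> to the integral of
  \<open>\<bar>\<psi>\<bar>\<^sup>p\<close> over the preimage of \<open>E\<close>.\<close>

lemma emeasure_pushforward_measure:
  assumes \<phi>: "\<phi> \<in> weighted_measure \<Omega> lam \<rightarrow>\<^sub>M restrict_space borel \<Omega>"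
    and \<psi>: "\<psi> \<in> borel_measurable (weighted_measure \<Omega> lam)"
    and E: "E \<in> sets (restrict_space borel \<Omega>)"
  shows "emeasure (pushforward_measure \<Omega> lam \<phi> \<psi> p) E =
    (\<integral>\<^sup>+z\<in>\<phi> -` E \<inter> \<Omega>. ennreal (cmod (\<psi> z) powr p) \<partial>weighted_measure \<Omega> lam)"
proof -
  have sp: "space (weighted_measure \<Omega> lam) = \<Omega>"
    by (simp add: weighted_measure_def)
  have m: "\<phi> \<in> density (weighted_measure \<Omega> lam) (\<lambda>z. ennreal (cmod (\<psi> z) powr p))
      \<rightarrow>\<^sub>M restrict_space borel \<Omega>"
    using \<phi> by simp
  have "\<phi> -` E \<inter> \<Omega> \<in> sets (weighted_measure \<Omega> lam)"
    using measurable_sets[OF \<phi> E] by (simp add: sp)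
  then show ?thesis
    unfolding pushforward_measure_def
    using \<psi> by (simp add: emeasure_distr[OF m E] emeasure_density sp)
qed

end

theory Submission
  imports Defs
begin

text \<open>
  The theorem is a change of variables. Writing \<open>\<mu>\<close> for the pushforward under \<open>\<phi>\<close> of the measure
  \<open>\<bar>\<psi>\<bar>\<^sup>p dV\<^sub>\<lambda>\<close>, every measurable \<open>f\<close> satisfies
  \<open>\<integral> \<bar>f\<bar>\<^sup>p d\<mu> = \<integral> \<bar>\<psi>\<bar>\<^sup>p \<bar>f \<circ> \<phi>\<bar>\<^sup>p dV\<^sub>\<lambda> = \<integral> \<bar>W f\<bar>\<^sup>p dV\<^sub>\<lambda>\<close>, where \<open>W f = \<psi> (f \<circ> \<phi>)\<close>,
  so \<open>f\<close> has the same norm in \<open>L\<^sup>p(\<mu>)\<close> as \<open>W f\<close> has in \<open>L\<^sup>p(dV\<^sub>\<lambda>)\<close>, and one is finite exactly when the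
  other is (\<open>Lp_functions_distr_density\<close>, \<open>Lp_norm_distr_density\<close>). Hence the inequality expressing that
  \<open>W\<close> is bounded on the Bergman space is literally the Carleson inequality for \<open>\<mu>\<close>.

  Two points remain. Membership of \<open>W f\<close> in the Bergman space also asks for holomorphy, which is the
  chain rule and the product rule in several variables; and a Carleson measure has to be finite,
  which is the hypothesis \<open>\<psi> \<in> L\<^sup>p(dV\<^sub>\<lambda>)\<close>.
\<close>

lemma holomorphic_fun_mult:
  assumes "holomorphic_fun f \<Omega>" "holomorphic_fun g \<Omega>"
  shows "holomorphic_fun (\<lambda>z. f z * g z) \<Omega>"
  unfolding holomorphic_fun_def
proof
  fix z assume z: "z \<in> \<Omega>"
  obtain D where D: "(f has_derivative D) (at z)" "\<And>c v. D (c *s v) = c * D v"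
    using assms(1) z unfolding holomorphic_fun_def by blast
  obtain E where E: "(g has_derivative E) (at z)" "\<And>c v. E (c *s v) = c * E v"
    using assms(2) z unfolding holomorphic_fun_def by blast
  have "((\<lambda>z. f z * g z) has_derivative (\<lambda>v. f z * E v + D v * g z)) (at z)"
    by (rule has_derivative_mult[OF D(1) E(1)])
  moreover have "f z * E (c *s v) + D (c *s v) * g z = c * (f z * E v + D v * g z)" for c v
    by (simp add: D(2) E(2) algebra_simps)
  ultimately show "\<exists>D. ((\<lambda>z. f z * g z) has_derivative D) (at z) \<and> (\<forall>c v. D (c *s v) = c * D v)"
    by blast
qed

text \<open>Holomorphy of a map is a condition on its coordinates; the chain rule needs one derivative of
  the whole map, assembled from theirs.\<close>

lemma holomorphic_map_has_derivative:
  fixes \<phi> :: "complex ^ 'n \<Rightarrow> complex ^ 'm"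
  assumes "holomorphic_map \<phi> \<Omega>" "z \<in> \<Omega>"
  obtains D where "(\<phi> has_derivative D) (at z)" "\<And>c v. D (c *s v) = c *s D v"
proof -
  have "\<forall>i. \<exists>D. ((\<lambda>z. \<phi> z $ i) has_derivative D) (at z) \<and> (\<forall>c v. D (c *s v) = c * D v)"
    using assms unfolding holomorphic_map_def holomorphic_fun_def by blast
  then obtain D where D: "\<And>i. ((\<lambda>z. \<phi> z $ i) has_derivative D i) (at z)"
      "\<And>i c v. D i (c *s v) = c * D i v"
    by metis
  have "(\<phi> has_derivative (\<lambda>v. \<chi> i. D i v)) (at z)"
  proof (subst has_derivative_componentwise_within, intro ballI)
    fix b :: "complex ^ 'm" assume "b \<in> Basis"
    then obtain i u where b: "b = axis i u"
      by (auto simp: Basis_vec_def)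
    show "((\<lambda>x. \<phi> x \<bullet> b) has_derivative (\<lambda>v. (\<chi> i. D i v) \<bullet> b)) (at z)"
      using has_derivative_inner_left[OF D(1)[of i], of u] by (simp add: b inner_axis)
  qed
  moreover have "(\<chi> i. D i (c *s v)) = c *s (\<chi> i. D i v)" for c v
    by (simp add: vec_eq_iff D(2))
  ultimately show thesis using that by blast
qed

lemma holomorphic_map_continuous_on:
  assumes "holomorphic_map \<phi> \<Omega>"
  shows "continuous_on \<Omega> \<phi>"
  by (rule continuous_at_imp_continuous_on)
    (metis assms has_derivative_continuous holomorphic_map_has_derivative)

lemma holomorphic_fun_compose:
  assumes "holomorphic_map \<phi> \<Omega>" "\<phi> ` \<Omega> \<subseteq> \<Omega>'" "holomorphic_fun f \<Omega>'"
  shows "holomorphic_fun (\<lambda>z. f (\<phi> z)) \<Omega>"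
  unfolding holomorphic_fun_def
proof
  fix z assume z: "z \<in> \<Omega>"
  obtain D where D: "(\<phi> has_derivative D) (at z)" "\<And>c v. D (c *s v) = c *s D v"
    using holomorphic_map_has_derivative[OF assms(1) z] by blast
  obtain E where E: "(f has_derivative E) (at (\<phi> z))" "\<And>c v. E (c *s v) = c * E v"
    using assms(2,3) z unfolding holomorphic_fun_def by blast
  have "((\<lambda>z. f (\<phi> z)) has_derivative (\<lambda>v. E (D v))) (at z)"
    by (rule has_derivative_compose[OF D(1) E(1)])
  moreover have "E (D (c *s v)) = c * E (D v)" for c v
    by (simp add: D(2) E(2))
  ultimately show "\<exists>D. ((\<lambda>z. f (\<phi> z)) has_derivative D) (at z) \<and> (\<forall>c v. D (c *s v) = c * D v)"
    by blast
qed

lemma sets_weighted_measure: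
  "sets (weighted_measure \<Omega> lam) = sets (restrict_space borel \<Omega>)"
  by (simp add: weighted_measure_def sets_volume_measure)

lemma holomorphic_self_map_measurable:
  assumes "holomorphic_map \<phi> \<Omega>" "\<phi> ` \<Omega> \<subseteq> \<Omega>"
  shows "\<phi> \<in> weighted_measure \<Omega> lam \<rightarrow>\<^sub>M restrict_space borel \<Omega>"
proof -
  have "\<phi> \<in> restrict_space borel \<Omega> \<rightarrow>\<^sub>M restrict_space borel \<Omega>"
    using assms(2) borel_measurable_continuous_on_restrict[OF holomorphic_map_continuous_on[OF assms(1)]]
    by (intro measurable_restrict_space2) (auto simp: space_restrict_space)
  then show ?thesis
    by (simp cong: measurable_cong_sets add: sets_weighted_measure)
qed

text \<open>Since \<open>\<bar>W f\<bar>\<^sup>p = \<bar>\<psi>\<bar>\<^sup>p (\<bar>f\<bar>\<^sup>p \<circ> \<phi>)\<close>, the image-measure and density formulas move integrability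
  between the two sides.\<close>

lemma Lp_functions_distr_density:
  assumes \<phi>: "\<phi> \<in> M \<rightarrow>\<^sub>M N" and \<psi>: "\<psi> \<in> borel_measurable M" and f: "f \<in> borel_measurable N"
  shows "f \<in> Lp_functions (distr (density M (\<lambda>z. ennreal (cmod (\<psi> z) powr p))) N \<phi>) p
    \<longleftrightarrow> weighted_composition \<phi> \<psi> f \<in> Lp_functions M p"
proof -
  note [measurable] = \<phi> \<psi> f
  show ?thesis
    by (simp add: Lp_functions_def weighted_composition_def integrable_distr_eq integrable_density
        norm_mult powr_mult)
qed

text \<open>The same computation for the norms. When \<open>\<bar>f\<bar>\<^sup>p\<close> is not integrable,
  both Bochner integrals are 0 by convention.\<close>

lemma Lp_norm_distr_density:
  assumes \<phi>: "\<phi> \<in> M \<rightarrow>\<^sub>M N" and \<psi>: "\<psi> \<in> borel_measurable M" and f: "f \<in> borel_measurable N"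
  shows "Lp_norm (distr (density M (\<lambda>z. ennreal (cmod (\<psi> z) powr p))) N \<phi>) p f
    = Lp_norm M p (weighted_composition \<phi> \<psi> f)"
proof -
  note [measurable] = \<phi> \<psi> f
  show ?thesis
    by (simp add: Lp_norm_def weighted_composition_def integral_distr integral_density
        norm_mult powr_mult)
qed

text \<open>The total mass is \<open>\<integral> \<bar>\<psi>\<bar>\<^sup>p dM\<close>.\<close>

lemma finite_measure_distr_density:
  assumes \<phi>: "\<phi> \<in> M \<rightarrow>\<^sub>M N" and \<psi>: "\<psi> \<in> Lp_functions M p"
  shows "finite_measure (distr (density M (\<lambda>z. ennreal (cmod (\<psi> z) powr p))) N \<phi>)"
proof -
  have [measurable]: "\<psi> \<in> borel_measurable M"
    and int: "integrable M (\<lambda>z. cmod (\<psi> z) powr p)"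
    using \<psi> by (auto simp: Lp_functions_def)
  have "(\<integral>\<^sup>+z. ennreal (cmod (\<psi> z) powr p) \<partial>M) < \<infinity>"
    using int by (simp add: integrable_iff_bounded)
  then have "finite_measure (density M (\<lambda>z. ennreal (cmod (\<psi> z) powr p)))"
    by (intro finite_measureI) (simp add: emeasure_density nn_integral_set_ennreal cong: nn_integral_cong)
  then show ?thesis
    using \<phi> by (intro finite_measure.finite_measure_distr) auto
qed

text \<open>Boundedness of an operator sees only membership of the images and their norms, so it can be
  compared between operators with different target spaces. Here \<open>W\<close> into the Bergman space is
  traded for the inclusion into \<open>L\<^sup>p(\<mu>)\<close>.\<close>

lemma bounded_operator_cong:
  assumes "\<And>f. f \<in> X \<Longrightarrow> T f \<in> Y \<longleftrightarrow> S f \<in> Z"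
    and "\<And>f. f \<in> X \<Longrightarrow> normY (T f) = normZ (S f)"
  shows "bounded_operator X normX Y normY T \<longleftrightarrow> bounded_operator X normX Z normZ S"
  using assms by (simp add: bounded_operator_def)

theorem theorem3p4:
  fixes \<Omega> :: "(complex ^ 'n) set"
    and \<phi> :: "complex ^ 'n \<Rightarrow> complex ^ 'n"
    and \<psi> :: "complex ^ 'n \<Rightarrow> complex"
    and p lam \<epsilon> :: real
  assumes "1 \<le> p"
    and "standard_bounded_symmetric_domain \<Omega>"
    and "0 < \<epsilon>"
    and "\<And>t. t < \<epsilon> \<Longrightarrow> integrable (volume_measure \<Omega>) (kernel_power \<Omega> t)"
    and "lam < \<epsilon>"
    and "holomorphic_map \<phi> \<Omega>"
    and "\<phi> ` \<Omega> \<subseteq> \<Omega>"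
    and "\<psi> \<in> weighted_bergman_space \<Omega> lam p"
  shows "bounded_operator
           (weighted_bergman_space \<Omega> lam p) (weighted_bergman_norm \<Omega> lam p)
           (weighted_bergman_space \<Omega> lam p) (weighted_bergman_norm \<Omega> lam p)
           (weighted_composition \<phi> \<psi>)
         \<longleftrightarrow> carleson_measure \<Omega> lam p (pushforward_measure \<Omega> lam \<phi> \<psi> p)"
proof -
  let ?M = "weighted_measure \<Omega> lam" and ?N = "restrict_space borel \<Omega>"
  let ?\<mu> = "pushforward_measure \<Omega> lam \<phi> \<psi> p"
  have \<phi>: "\<phi> \<in> ?M \<rightarrow>\<^sub>M ?N"
    using assms(6,7) by (rule holomorphic_self_map_measurable)
  have hol: "holomorphic_fun \<psi> \<Omega>" and Lp: "\<psi> \<in> Lp_functions ?M p"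
    and \<psi>: "\<psi> \<in> borel_measurable ?M"
    using assms(8) by (auto simp: bergman_space_def Lp_functions_def)
  have W_hol: "holomorphic_fun (weighted_composition \<phi> \<psi> f) \<Omega>"
    and f_meas: "f \<in> borel_measurable ?N"
    if "f \<in> weighted_bergman_space \<Omega> lam p" for f
    using that holomorphic_fun_mult[OF hol holomorphic_fun_compose[OF assms(6,7)]]
    by (auto simp: bergman_space_def Lp_functions_def weighted_composition_def sets_weighted_measure
        cong: measurable_cong_sets)
  have "bounded_operator
      (weighted_bergman_space \<Omega> lam p) (weighted_bergman_norm \<Omega> lam p)
      (weighted_bergman_space \<Omega> lam p) (weighted_bergman_norm \<Omega> lam p) (weighted_composition \<phi> \<psi>)
    \<longleftrightarrow> bounded_operator
      (weighted_bergman_space \<Omega> lam p) (weighted_bergman_norm \<Omega> lam p)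
      (Lp_functions ?\<mu> p) (Lp_norm ?\<mu> p) (\<lambda>f. f)"
  proof (rule bounded_operator_cong)
    fix f assume f: "f \<in> weighted_bergman_space \<Omega> lam p"
    show "weighted_composition \<phi> \<psi> f \<in> weighted_bergman_space \<Omega> lam p \<longleftrightarrow> f \<in> Lp_functions ?\<mu> p"
      using W_hol[OF f] Lp_functions_distr_density[OF \<phi> \<psi> f_meas[OF f]]
      by (simp add: bergman_space_def pushforward_measure_def)
    show "weighted_bergman_norm \<Omega> lam p (weighted_composition \<phi> \<psi> f) = Lp_norm ?\<mu> p f"
      using Lp_norm_distr_density[OF \<phi> \<psi> f_meas[OF f]]
      by (simp add: pushforward_measure_def)
  qed
  moreover have "finite_measure ?\<mu>"
    unfolding pushforward_measure_def using \<phi> Lp by (rule finite_measure_distr_density)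
  moreover have "sets ?\<mu> = sets ?N"
    by (simp add: pushforward_measure_def)
  ultimately show ?thesis
    by (simp add: carleson_measure_def)
qed

end
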